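(* Let $X$ be a non-empty set, $Y$ a real Hausdorff locally convex topological vector space, $C\subseteq Y$ a closed set such that $Y\setminus C$ is convex, $I\subseteq\mathbb{R}$ an interval containing $0$, and $f,g:X\to Y$ two functions. Assume that: $(a_1)$ the set $f^{-1}(C)$ is non-empty and the set $\{(f(x),g(x)) : x\in f^{-1}(C)\}$ is compact in $Y\times Y$; $(a_2)$ for each $x\in X$, there exists $\lambda\in I$ such that $f(x)+\lambda g(x)\in Y\setminus C$. Then there exist a compact interval $[a^*,b^*]\subseteq I$ and a point $x^*\in f^{-1}(C)$ satisfying $$f(x^* )+\lambda g(x^* )\in Y\setminus C\quad\text{for all }\lambda\in (a^*,b^* ),$$ such that, if we put $$V=\bigcup_{\lambda\in (a^*,b^* )}\{x\in X : f(x)+\lambda g(x)\in Y\setminus C\},$$ at least one of the following assertions holds: $(p_1)$ $f(x^* )+a^*g(x^* )\in \partial C$ and $(f+a^*g)(V)\cap C\subseteq\partial\big((f+a^*g)(V)\big)\cap \partial C$; $(p_2)$ $f(x^* )+b^*g(x^* )\in \partial C$ and $(f+b^*g)(V)\cap C\subseteq\partial\big((f+b^*g)(V)\big)\cap \partial C$. In particular, $[a^*,b^*]$ and $x^*$ can be found so that $(p_1)$ holds when $0=\inf I$, and so that $(p_2)$ holds when $0=\sup I$.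
   Context: "Interval" means a non-empty connected subset of $\mathbb{R}$ with more than one point (so $a^*<b^*$). $\partial$ denotes the topological boundary in $Y$. $(a^*,b^* )$ denotes the open interval. *)

theory Defs
  imports "HOL-Analysis.Analysis"
begin

text \<open>
  Real Hausdorff locally convex topological vector spaces. Continuity of addition and
  negation comes from \<^class>\<open>topological_ab_group_add\<close>; scalar multiplication is assumed to be
  jointly continuous. Local convexity is stated at the origin, which suffices by translation.
  The constant \<^const>\<open>convex\<close> cannot occur inside the class specification, so it is unfolded
  there and recovered in the lemma below.
\<close>

class hausdorff_lctvs = real_vector + topological_ab_group_add + t2_space +
  assumes tendsto_scaleR_nhds:
    "((\<lambda>p. fst p *\<^sub>R snd p) \<longlongrightarrow> r *\<^sub>R y) (nhds r \<times>\<^sub>F nhds y)"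
  and convex_nhds_zero_raw:
    "\<lbrakk>open U; 0 \<in> U\<rbrakk> \<Longrightarrow> \<exists>W. open W \<and> 0 \<in> W \<and> W \<subseteq> U \<and>
       (\<forall>x\<in>W. \<forall>y\<in>W. \<forall>u\<ge>0. \<forall>v\<ge>0. u + v = 1 \<longrightarrow> u *\<^sub>R x + v *\<^sub>R y \<in> W)"

lemma convex_nhds_zero:
  fixes U :: "'a::hausdorff_lctvs set"
  assumes "open U" "0 \<in> U"
  shows "\<exists>W. open W \<and> 0 \<in> W \<and> W \<subseteq> U \<and> convex W"
  using convex_nhds_zero_raw[OF assms] unfolding convex_def .

instance real_normed_vector \<subseteq> hausdorff_lctvs
proof
  fix r :: real and y :: 'a
  have "((\<lambda>p. fst p) \<longlongrightarrow> r) (nhds r \<times>\<^sub>F nhds y)" "((\<lambda>p. snd p) \<longlongrightarrow> y) (nhds r \<times>\<^sub>F nhds y)"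
    by (rule filterlim_fst, rule filterlim_snd)
  then show "((\<lambda>p. fst p *\<^sub>R snd p) \<longlongrightarrow> r *\<^sub>R y) (nhds r \<times>\<^sub>F nhds y)"
    by (rule tendsto_scaleR)
next
  fix U :: "'a set"
  assume "open U" "0 \<in> U"
  then obtain e where "e > 0" "ball 0 e \<subseteq> U"
    using open_contains_ball by blast
  moreover have "convex (ball (0::'a) e)"
    by simp
  ultimately show "\<exists>W. open W \<and> 0 \<in> W \<and> W \<subseteq> U \<and>
       (\<forall>x\<in>W. \<forall>y\<in>W. \<forall>u\<ge>0. \<forall>v\<ge>0. u + v = 1 \<longrightarrow> u *\<^sub>R x + v *\<^sub>R y \<in> W)"
    unfolding convex_def by (intro exI[of _ "ball 0 e"]) auto
qed

definition sweep_set ::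
  "'x set \<Rightarrow> 'y::real_vector set \<Rightarrow> ('x \<Rightarrow> 'y) \<Rightarrow> ('x \<Rightarrow> 'y) \<Rightarrow> real \<Rightarrow> real \<Rightarrow> 'x set"
  where "sweep_set X C f g a b = (\<Union>l\<in>{a<..<b}. {x \<in> X. f x + l *\<^sub>R g x \<in> - C})"

definition admissible ::
  "'x set \<Rightarrow> 'y::real_vector set \<Rightarrow> ('x \<Rightarrow> 'y) \<Rightarrow> ('x \<Rightarrow> 'y) \<Rightarrow> real set \<Rightarrow> real \<Rightarrow> real \<Rightarrow> 'x \<Rightarrow> bool"
  where "admissible X C f g I a b x \<longleftrightarrow>
    a < b \<and> {a..b} \<subseteq> I \<and> x \<in> X \<and> f x \<in> C \<and> (\<forall>l\<in>{a<..<b}. f x + l *\<^sub>R g x \<in> - C)"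

text \<open>
  The two alternatives of the theorem differ only in the endpoint \<open>c\<close> of the interval at
  which the pencil \<open>f + c g\<close> is considered.
\<close>

definition boundary_property ::
  "'y::{real_vector, topological_space} set \<Rightarrow> ('x \<Rightarrow> 'y) \<Rightarrow> ('x \<Rightarrow> 'y) \<Rightarrow> 'x set \<Rightarrow> 'x \<Rightarrow> real \<Rightarrow> bool"
  where "boundary_property C f g V x c \<longleftrightarrow>
    f x + c *\<^sub>R g x \<in> frontier C \<and>
    (\<lambda>z. f z + c *\<^sub>R g z) ` V \<inter> C \<subseteq> frontier ((\<lambda>z. f z + c *\<^sub>R g z) ` V) \<inter> frontier C"

end

theory Submission
  imports Defs
begin

text \<open>
  For \<open>x\<close> with \<open>f x \<in> C\<close>, the parameters \<open>l\<close> with \<open>f x + l g x \<notin> C\<close> form an open interval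
  missing \<open>0\<close>, so it lies on one side of \<open>0\<close>. The points whose interval lies on the positive
  side form a compact set, on which the infimum of the interval is upper semicontinuous. A point
  maximising this infimum gives \<open>x\<^sup>*\<close> and \<open>a\<^sup>*\<close>, and any parameter of its interval serves as
  \<open>b\<^sup>*\<close>. By maximality, \<open>f + a\<^sup>* g\<close> maps \<open>V\<close> into \<open>C\<close> only at boundary points of \<open>C\<close>. Such a
  point \<open>w\<close> is not interior to the image: reflecting in \<open>w\<close> a point of the convex set \<open>- C\<close>
  near \<open>w\<close> produces interior points of \<open>C\<close> near \<open>w\<close>. The negative side follows by replacing
  \<open>g\<close> with \<open>- g\<close>.
\<close>

section \<open>Continuity of lines and pencils\<close>

lemma tendsto_scaleR_lctvs:
  fixes k :: "'a \<Rightarrow> 'y::hausdorff_lctvs"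
  assumes "(h \<longlongrightarrow> r) F" "(k \<longlongrightarrow> y) F"
  shows "((\<lambda>x. h x *\<^sub>R k x) \<longlongrightarrow> r *\<^sub>R y) F"
  using filterlim_compose[OF tendsto_scaleR_nhds filterlim_Pair[OF assms]] by simp

lemma continuous_on_scaleR_lctvs:
  fixes k :: "'a::topological_space \<Rightarrow> 'y::hausdorff_lctvs"
  assumes "continuous_on S h" "continuous_on S k"
  shows "continuous_on S (\<lambda>x. h x *\<^sub>R k x)"
  using assms unfolding continuous_on_def by (blast intro: tendsto_scaleR_lctvs)

lemma open_vimage_line:
  fixes u v :: "'y::hausdorff_lctvs"
  assumes "open D"
  shows "open {l::real. u + l *\<^sub>R v \<in> D}"
proof -
  have "continuous_on UNIV (\<lambda>l::real. u + l *\<^sub>R v)"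
    by (intro continuous_on_add continuous_on_scaleR_lctvs continuous_intros)
  from open_vimage[OF assms this] show ?thesis by (simp add: vimage_def)
qed

text \<open>Here the parameter \<open>l\<close> is fixed and the pair \<open>(f x, g x)\<close>
  varies. The set \<open>X\<close> has no topology, so compactness and semicontinuity are handled on
  these pairs.\<close>

lemma open_vimage_pencil:
  fixes D :: "'y::hausdorff_lctvs set"
  assumes "open D"
  shows "open {p. fst p + (l::real) *\<^sub>R snd p \<in> D}"
proof -
  have "continuous_on UNIV (\<lambda>p::'y \<times> 'y. fst p + l *\<^sub>R snd p)"
    by (intro continuous_on_add continuous_on_scaleR_lctvs continuous_intros)
  from open_vimage[OF assms this] show ?thesis by (simp add: vimage_def)
qed

section \<open>Convexity and boundary points\<close>

lemma convex_line_between: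
  fixes u v :: "'y::real_vector"
  assumes D: "convex D" and r: "u + r *\<^sub>R v \<in> D" and t: "u + t *\<^sub>R v \<in> D"
    and "r \<le> s" "s \<le> t"
  shows "u + s *\<^sub>R v \<in> D"
proof (cases "r = t")
  case True
  then show ?thesis using assms by simp
next
  case False
  define c where "c = (s - r) / (t - r)"
  have c: "0 \<le> c" "c \<le> 1" "s = r + c * (t - r)"
    using False assms by (auto simp: c_def divide_simps)
  have "(1 - c) *\<^sub>R (u + r *\<^sub>R v) + c *\<^sub>R (u + t *\<^sub>R v) \<in> D"
    using convexD_alt[OF D r t] c by simp
  also have "(1 - c) *\<^sub>R (u + r *\<^sub>R v) + c *\<^sub>R (u + t *\<^sub>R v) = u + s *\<^sub>R v"
    by (simp add: c(3) algebra_simps)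
  finally show ?thesis .
qed

text \<open>If the point were interior to \<open>C\<close>, all parameters near \<open>c\<close>
  would give points of \<open>C\<close>, including some just to the right of \<open>c\<close>, where
  the line leaves \<open>C\<close>.\<close>

lemma line_in_frontier:
  fixes u v :: "'y::hausdorff_lctvs" and c :: real
  assumes C: "u + c *\<^sub>R v \<in> C" and e: "\<And>e. c < e \<Longrightarrow> \<exists>l. c < l \<and> l < e \<and> u + l *\<^sub>R v \<in> - C"
  shows "u + c *\<^sub>R v \<in> frontier C"
proof -
  have "u + c *\<^sub>R v \<notin> interior C"
  proof
    assume "u + c *\<^sub>R v \<in> interior C"
    then have "c \<in> {l. u + l *\<^sub>R v \<in> interior C}" by simp
    with open_vimage_line[OF open_interior] obtain d
      where d: "d > 0" "\<And>l. dist l c < d \<Longrightarrow> u + l *\<^sub>R v \<in> interior C"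
      unfolding open_dist by blast
    obtain l where l: "c < l" "l < c + d" "u + l *\<^sub>R v \<in> - C" using e[of "c + d"] d(1) by auto
    from d(2)[of l] l(1,2) have "u + l *\<^sub>R v \<in> interior C" by (simp add: dist_real_def)
    with l(3) interior_subset show False by blast
  qed
  with C closure_subset show ?thesis unfolding frontier_def by blast
qed

lemma not_interior_of_meets_frontier_only:
  fixes C W :: "'y::hausdorff_lctvs set"
  assumes C: "closed C" "convex (- C)" and w: "w \<in> C" and W: "W \<inter> C \<subseteq> frontier C"
  shows "w \<notin> interior W"
proof
  assume wW: "w \<in> interior W"
  define r where "r = (\<lambda>p. (w + w) - p)"
  have cr: "continuous_on UNIV r" unfolding r_def by (intro continuous_intros)
  have "w \<in> frontier C" using wW w W interior_subset by blast
  then have cl: "w \<in> closure (- C)" unfolding closure_complement frontier_def by simp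
  have op: "open (r -` interior W)" by (rule open_vimage[OF open_interior cr])
  have "w \<in> r -` interior W" using wW by (simp add: r_def)
  with cl op obtain p where p: "p \<in> - C" "r p \<in> interior W"
    by (auto simp: closure_iff_nhds_not_empty)
  \<comment> \<open>The midpoint of \<open>q\<close> and \<open>r q\<close> is \<open>w\<close>.
    Were both in the convex set \<open>- C\<close>, so would be \<open>w\<close>.\<close>
  have rC: "r q \<in> C" if "q \<in> - C" for q
  proof (rule ccontr)
    assume "r q \<notin> C"
    with C(2) that have "(1/2) *\<^sub>R q + (1/2) *\<^sub>R r q \<in> - C" by (intro convexD) auto
    moreover have "(1/2) *\<^sub>R q + (1/2) *\<^sub>R r q = w"
      by (simp add: r_def flip: scaleR_add_right)
    ultimately show False using w by simp
  qed
  have rr: "r (r q) = q" for q by (simp add: r_def)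
  \<comment> \<open>Since \<open>r\<close> is an involution, the reflection of the open set
    \<open>- C\<close> is an open subset of \<open>C\<close>. So \<open>r p\<close> is interior to
    \<open>C\<close>, although as a point of \<open>W\<close> in \<open>C\<close> it must lie in the
    frontier.\<close>
  have "r -` (- C) \<subseteq> C" using rC rr by (metis subsetI vimageE)
  moreover have "open (r -` (- C))" using C(1) cr by (intro open_vimage) auto
  moreover have "r p \<in> r -` (- C)" using p(1) rr by simp
  ultimately have "r p \<in> interior C" by (meson interiorI)
  moreover have "r p \<in> frontier C" using p rC W interior_subset by blast
  ultimately show False unfolding frontier_def by blast
qed

section \<open>Maxima of upper semicontinuous functions\<close>

text \<open>Without a maximum, the relatively open sets where \<open>a\<close> is below
  \<open>a q\<close>, for \<open>q\<close> in \<open>K\<close>, cover \<open>K\<close>. In a finite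
  subcover, a centre \<open>q\<close> with the largest value lies in none of the sets.\<close>

lemma compact_attains_sup_usc:
  fixes a :: "'a::topological_space \<Rightarrow> 'b::linorder"
  assumes "compact K" "K \<noteq> {}"
    and usc: "\<And>t. \<exists>T. open T \<and> {x \<in> K. a x < t} = K \<inter> T"
  shows "\<exists>x\<in>K. \<forall>y\<in>K. a y \<le> a x"
proof (rule ccontr)
  assume no: "\<not> ?thesis"
  obtain T where T: "\<And>t. open (T t)" "\<And>t. {x \<in> K. a x < t} = K \<inter> T t"
    using usc by metis
  have "K \<subseteq> (\<Union>q\<in>K. T (a q))" using no T(2) by (fastforce simp: not_le)
  with \<open>compact K\<close> T(1) obtain Q where Q: "Q \<subseteq> K" "finite Q" "K \<subseteq> (\<Union>q\<in>Q. T (a q))"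
    by (metis compactE_image)
  with \<open>K \<noteq> {}\<close> have "Q \<noteq> {}" by auto
  have "Max (a ` Q) \<in> a ` Q" using Q \<open>Q \<noteq> {}\<close> by simp
  then obtain q where q: "q \<in> Q" "a q = Max (a ` Q)" by auto
  with Q obtain q' where q': "q' \<in> Q" "q \<in> T (a q')" by blast
  with T(2) Q q have "a q < a q'" by blast
  moreover have "a q' \<le> a q" using q q' Q by simp
  ultimately show False by simp
qed

section \<open>The positive side\<close>

lemma boundary_property_left_endpoint:
  fixes X :: "'x set" and C :: "'y::hausdorff_lctvs set" and I :: "real set"
    and f g :: "'x \<Rightarrow> 'y"
  assumes C: "closed C" "convex (- C)"
    and I: "connected I" "0 \<in> I"
    and K: "compact ((\<lambda>x. (f x, g x)) ` {x \<in> X. f x \<in> C})"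
    and hit: "\<forall>x\<in>X. \<exists>l\<in>I. f x + l *\<^sub>R g x \<in> - C"
    and pos: "x0 \<in> X" "f x0 \<in> C" "l0 \<in> I" "l0 > 0" "f x0 + l0 *\<^sub>R g x0 \<in> - C"
  shows "\<exists>a b x. admissible X C f g I a b x \<and>
           boundary_property C f g (sweep_set X C f g a b) x a"
proof -
  \<comment> \<open>\<open>S p\<close> collects the positive parameters at which the line of
    \<open>p\<close> leaves \<open>C\<close>. \<open>N\<close> consists of the pairs whose line
    leaves \<open>C\<close> at a negative parameter. Removing the open set \<open>N\<close>
    preserves compactness, and on the remaining \<open>K'\<close> the hypothesis \<open>hit\<close>
    makes \<open>S p\<close> non-empty.\<close>
  define S where "S = (\<lambda>p::'y \<times> 'y. {l \<in> I. 0 < l \<and> fst p + l *\<^sub>R snd p \<in> - C})"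
  define N where "N = (\<Union>l\<in>{l \<in> I. l < 0}. {p::'y \<times> 'y. fst p + l *\<^sub>R snd p \<in> - C})"
  define K' where "K' = (\<lambda>x. (f x, g x)) ` {x \<in> X. f x \<in> C} - N"
  define a where "a = (\<lambda>p. Inf (S p))"
  have oC: "open (- C)" using C by auto
  have "open N" unfolding N_def by (intro open_UN ballI open_vimage_pencil oC)
  then have "compact K'" unfolding K'_def using K compact_diff by blast
  have in_I: "s \<in> I" if "r \<in> I" "t \<in> I" "r \<le> s" "s \<le> t" for r s t
    using connected_contains_Icc[OF I(1) that(1,2)] that by auto
  have between: "u + s *\<^sub>R v \<in> - C"
    if "u + r *\<^sub>R v \<in> - C" "u + t *\<^sub>R v \<in> - C" "r \<le> s" "s \<le> t" for u v :: 'y and r s t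
    using convex_line_between[OF C(2)] that by blast
  have K'I: "(f x, g x) \<in> K'"
    if "x \<in> X" "f x \<in> C" "0 < l" "f x + l *\<^sub>R g x \<in> - C" for x l
  proof -
    have "(f x, g x) \<notin> N"
    proof
      assume "(f x, g x) \<in> N"
      then obtain m where m: "m < 0" "f x + m *\<^sub>R g x \<in> - C" by (auto simp: N_def)
      from between[OF m(2) that(4), of 0] m that show False by simp
    qed
    then show ?thesis using that by (auto simp: K'_def)
  qed
  have "K' \<noteq> {}" using K'I[OF pos(1,2,4,5)] by auto
  have bdd: "bdd_below (S p)" for p by (rule bdd_belowI[of _ 0]) (auto simp: S_def)
  have S_ne: "S p \<noteq> {}" if p: "p \<in> K'" for p
  proof -
    obtain x where x: "x \<in> X" "f x \<in> C" "p = (f x, g x)" "p \<notin> N" using p by (auto simp: K'_def)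
    obtain l where l: "l \<in> I" "f x + l *\<^sub>R g x \<in> - C" using hit x by blast
    have "l \<noteq> 0" using x l by auto
    moreover have "\<not> l < 0" using x l by (auto simp: N_def)
    ultimately show ?thesis using x l by (force simp: S_def)
  qed
  \<comment> \<open>Upper semicontinuity of \<open>a\<close>: the infimum is below \<open>t\<close>
    exactly when some parameter of \<open>S p\<close> is, and each single parameter imposes an open
    condition on \<open>p\<close>.\<close>
  have "\<exists>T. open T \<and> {p \<in> K'. a p < t} = K' \<inter> T" for t
  proof (intro exI conjI)
    let ?T = "\<Union>l\<in>{l \<in> I. 0 < l \<and> l < t}. {p::'y \<times> 'y. fst p + l *\<^sub>R snd p \<in> - C}"
    show "open ?T" by (intro open_UN ballI open_vimage_pencil oC)
    have "a p < t \<longleftrightarrow> p \<in> ?T" if "p \<in> K'" for p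
      unfolding a_def cInf_less_iff[OF S_ne[OF that] bdd] by (auto simp: S_def)
    then show "{p \<in> K'. a p < t} = K' \<inter> ?T" by blast
  qed
  from compact_attains_sup_usc[OF \<open>compact K'\<close> \<open>K' \<noteq> {}\<close> this]
  obtain p where p: "p \<in> K'" and max: "\<And>q. q \<in> K' \<Longrightarrow> a q \<le> a p" by blast
  obtain x where x: "x \<in> X" "f x \<in> C" "p = (f x, g x)" using p by (auto simp: K'_def)
  define c where "c = a p"
  have c0: "0 \<le> c"
    unfolding c_def a_def by (rule cInf_greatest[OF S_ne[OF p]]) (auto simp: S_def)
  obtain b where b: "b \<in> S p" using S_ne[OF p] by blast
  \<comment> \<open>The bound \<open>a q \<le> c\<close> holds at the maximiser and, by maximality,
    at every other pair of \<open>K'\<close>.\<close>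
  have approx: "\<exists>l. l \<in> S q \<and> l < e" if "q \<in> K'" "a q \<le> c" "c < e" for q e
    using that cInf_less_iff[OF S_ne[OF that(1)] bdd, of e] by (auto simp: a_def)
  have xC: "f x + c *\<^sub>R g x \<in> C"
  proof (rule ccontr)
    assume n: "f x + c *\<^sub>R g x \<notin> C"
    with x have "c > 0" using c0 by (cases "c = 0") auto
    have "c \<in> {l. f x + l *\<^sub>R g x \<in> - C}" using n by simp
    with open_vimage_line[OF oC] obtain d
      where d: "d > 0" "\<And>l. dist l c < d \<Longrightarrow> f x + l *\<^sub>R g x \<in> - C"
      unfolding open_dist by blast
    \<comment> \<open>Subtracting at most \<open>c/2\<close> keeps \<open>l\<close> positive, and at
      most \<open>d/2\<close> keeps the point outside \<open>C\<close>. Then \<open>l\<close>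
      belongs to \<open>S p\<close> but is below its infimum.\<close>
    define l where "l = c - min (d/2) (c/2)"
    have l: "0 < l" "l < c" "dist l c < d"
      using d(1) \<open>c > 0\<close> by (auto simp: l_def dist_real_def min_def)
    have "c \<le> b" unfolding c_def a_def using cInf_lower[OF b bdd] .
    then have "l \<in> S p"
      using d(2)[OF l(3)] l b x in_I[OF I(2), of b l] by (auto simp: S_def)
    from cInf_lower[OF this bdd] l show False by (simp add: c_def a_def)
  qed
  have S_above: "c < l" if "l \<in> S p" for l
  proof -
    have "c \<le> l" unfolding c_def a_def using cInf_lower[OF that bdd] .
    moreover have "l \<noteq> c" using that x xC by (auto simp: S_def)
    ultimately show ?thesis by simp
  qed
  have bI: "b \<in> I" and b_out: "f x + b *\<^sub>R g x \<in> - C" and "c < b"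
    using b x S_above by (auto simp: S_def)
  have "f x + l *\<^sub>R g x \<in> - C" if l: "l \<in> {c<..<b}" for l
  proof -
    obtain m where "m \<in> S p" "m < l" using approx[OF p, of l] l by (auto simp: c_def)
    with between[OF _ b_out, of m l] l x show ?thesis by (auto simp: S_def)
  qed
  then have adm: "admissible X C f g I c b x"
    unfolding admissible_def using \<open>c < b\<close> x in_I[OF I(2) bI] c0 by auto
  define W where "W = (\<lambda>z. f z + c *\<^sub>R g z) ` sweep_set X C f g c b"
  have "f x + c *\<^sub>R g x \<in> frontier C"
  proof (rule line_in_frontier[OF xC])
    fix e assume "c < e"
    then obtain l where "l \<in> S p" "l < e" using approx[OF p] by (auto simp: c_def)
    with S_above x show "\<exists>l. c < l \<and> l < e \<and> f x + l *\<^sub>R g x \<in> - C" by (auto simp: S_def)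
  qed
  moreover have WC: "W \<inter> C \<subseteq> frontier C"
  proof
    fix w assume "w \<in> W \<inter> C"
    then obtain z m where z: "z \<in> X" "f z + m *\<^sub>R g z \<in> - C" "c < m" "m < b"
      and w: "w = f z + c *\<^sub>R g z" "f z + c *\<^sub>R g z \<in> C"
      by (auto simp: W_def sweep_set_def)
    \<comment> \<open>Otherwise the line would be outside \<open>C\<close> at both \<open>0\<close>
      and \<open>m\<close>, hence at \<open>c\<close> in between, contradicting the choice of
      \<open>w\<close>.\<close>
    have "f z \<in> C"
      using between[of "f z" 0 "g z" m c] z w c0 by auto
    then have q: "(f z, g z) \<in> K'" using K'I[of z m] z c0 by simp
    have "f z + c *\<^sub>R g z \<in> frontier C"
    proof (rule line_in_frontier[OF w(2)])
      fix e assume "c < e"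
      then obtain l where l: "l \<in> S (f z, g z)" "l < e"
        using approx[OF q] max[OF q] by (auto simp: c_def)
      \<comment> \<open>If \<open>l \<le> c\<close>, then \<open>c\<close> would lie between
        \<open>l\<close> and \<open>m\<close>, where the line is outside \<open>C\<close>, and
        convexity would put \<open>w\<close> outside \<open>C\<close>.\<close>
      have "c < l" using between[of "f z" l "g z" m c] l z w by (fastforce simp: S_def)
      with l show "\<exists>l. c < l \<and> l < e \<and> f z + l *\<^sub>R g z \<in> - C" by (auto simp: S_def)
    qed
    with w show "w \<in> frontier C" by simp
  qed
  moreover have "W \<inter> C \<subseteq> frontier W"
    using not_interior_of_meets_frontier_only[OF C _ WC] closure_subset
    unfolding frontier_def by blast
  ultimately have "boundary_property C f g (sweep_set X C f g c b) x c"
    unfolding boundary_property_def W_def by blast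
  with adm show ?thesis by blast
qed

section \<open>The negative side by reflection\<close>

lemma sweep_set_reflect: "sweep_set X C f (\<lambda>x. - g x) a b = sweep_set X C f g (- b) (- a)"
proof -
  have "(\<exists>l\<in>{a<..<b}. f x + l *\<^sub>R (- g x) \<in> - C) \<longleftrightarrow>
      (\<exists>l\<in>{- b<..<- a}. f x + l *\<^sub>R g x \<in> - C)" for x
  proof
    assume "\<exists>l\<in>{a<..<b}. f x + l *\<^sub>R (- g x) \<in> - C"
    then obtain l where "l \<in> {a<..<b}" "f x + l *\<^sub>R (- g x) \<in> - C" by blast
    then show "\<exists>l\<in>{- b<..<- a}. f x + l *\<^sub>R g x \<in> - C" by (intro bexI[of _ "- l"]) auto
  next
    assume "\<exists>l\<in>{- b<..<- a}. f x + l *\<^sub>R g x \<in> - C"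
    then obtain l where "l \<in> {- b<..<- a}" "f x + l *\<^sub>R g x \<in> - C" by blast
    then show "\<exists>l\<in>{a<..<b}. f x + l *\<^sub>R (- g x) \<in> - C" by (intro bexI[of _ "- l"]) auto
  qed
  then show ?thesis unfolding sweep_set_def by blast
qed

lemma admissible_reflect:
  assumes "admissible X C f (\<lambda>x. - g x) (uminus ` I) a b x"
  shows "admissible X C f g I (- b) (- a) x"
proof -
  from assms have ab: "a < b" "{a..b} \<subseteq> uminus ` I" "x \<in> X" "f x \<in> C"
    and out: "\<And>l. l \<in> {a<..<b} \<Longrightarrow> f x + l *\<^sub>R (- g x) \<in> - C"
    unfolding admissible_def by blast+
  have "l \<in> I" if "l \<in> {- b..- a}" for l
  proof -
    have "- l \<in> uminus ` I" using that ab(2) by auto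
    then show ?thesis by auto
  qed
  moreover have "f x + l *\<^sub>R g x \<in> - C" if "l \<in> {- b<..<- a}" for l
    using out[of "- l"] that by auto
  ultimately show ?thesis using ab unfolding admissible_def by auto
qed

lemma boundary_property_reflect:
  "boundary_property C f (\<lambda>x. - g x) V x c \<longleftrightarrow> boundary_property C f g V x (- c)"
  by (simp add: boundary_property_def)

text \<open>Replacing \<open>g\<close> by \<open>- g\<close> and \<open>I\<close> by its mirror
  image turns the negative parameter \<open>l0\<close> into a positive one. Reflecting back, the
  left endpoint \<open>a\<close> becomes the right endpoint \<open>- a\<close>.\<close>

lemma boundary_property_right_endpoint:
  fixes X :: "'x set" and C :: "'y::hausdorff_lctvs set" and I :: "real set"
    and f g :: "'x \<Rightarrow> 'y"
  assumes C: "closed C" "convex (- C)"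
    and I: "connected I" "0 \<in> I"
    and K: "compact ((\<lambda>x. (f x, g x)) ` {x \<in> X. f x \<in> C})"
    and hit: "\<forall>x\<in>X. \<exists>l\<in>I. f x + l *\<^sub>R g x \<in> - C"
    and neg: "x0 \<in> X" "f x0 \<in> C" "l0 \<in> I" "l0 < 0" "f x0 + l0 *\<^sub>R g x0 \<in> - C"
  shows "\<exists>a b x. admissible X C f g I a b x \<and>
           boundary_property C f g (sweep_set X C f g a b) x b"
proof -
  have "connected (uminus ` I)" by (intro connected_continuous_image I continuous_intros)
  moreover have "0 \<in> uminus ` I" using I(2) by force
  moreover have "compact ((\<lambda>x. (f x, - g x)) ` {x \<in> X. f x \<in> C})"
  proof -
    have "compact ((\<lambda>p. (fst p, - snd p)) ` (\<lambda>x. (f x, g x)) ` {x \<in> X. f x \<in> C})"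
      by (intro compact_continuous_image K continuous_intros)
    then show ?thesis by (simp add: image_image)
  qed
  moreover have "\<forall>x\<in>X. \<exists>l\<in>uminus ` I. f x + l *\<^sub>R (- g x) \<in> - C" using hit by simp
  moreover have "- l0 \<in> uminus ` I" "- l0 > 0" "f x0 + (- l0) *\<^sub>R (- g x0) \<in> - C"
    using neg by auto
  ultimately obtain a b x where "admissible X C f (\<lambda>x. - g x) (uminus ` I) a b x"
    "boundary_property C f (\<lambda>x. - g x) (sweep_set X C f (\<lambda>x. - g x) a b) x a"
    using boundary_property_left_endpoint[OF C, of "uminus ` I" f "\<lambda>x. - g x" X x0 "- l0"] neg(1,2)
    by blast
  then have "admissible X C f g I (- b) (- a) x"
    "boundary_property C f g (sweep_set X C f g (- b) (- a)) x (- a)"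
    by (simp_all add: admissible_reflect sweep_set_reflect boundary_property_reflect)
  then show ?thesis by blast
qed

text \<open>A single point of \<open>X\<close> with \<open>f x \<in> C\<close> decides the side, by
  the sign of a parameter at which its line leaves \<open>C\<close>. The conditions
  \<open>bdd_below I\<close> and \<open>bdd_above I\<close> make \<open>Inf I\<close> and
  \<open>Sup I\<close> the true infimum and supremum.\<close>

theorem theorem3:
  fixes X :: "'x set" and C :: "'y::hausdorff_lctvs set" and I :: "real set"
    and f g :: "'x \<Rightarrow> 'y"
  assumes "X \<noteq> {}"
    and "closed C" and "convex (- C)"
    and "connected I" and "\<exists>s\<in>I. \<exists>t\<in>I. s \<noteq> t" and "0 \<in> I"
    and "{x \<in> X. f x \<in> C} \<noteq> {}"
    and "compact ((\<lambda>x. (f x, g x)) ` {x \<in> X. f x \<in> C})"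
    and "\<forall>x\<in>X. \<exists>l\<in>I. f x + l *\<^sub>R g x \<in> - C"
  shows "(\<exists>a b x. admissible X C f g I a b x \<and>
           (boundary_property C f g (sweep_set X C f g a b) x a \<or>
            boundary_property C f g (sweep_set X C f g a b) x b)) \<and>
         (bdd_below I \<and> Inf I = 0 \<longrightarrow>
           (\<exists>a b x. admissible X C f g I a b x \<and>
              boundary_property C f g (sweep_set X C f g a b) x a)) \<and>
         (bdd_above I \<and> Sup I = 0 \<longrightarrow>
           (\<exists>a b x. admissible X C f g I a b x \<and>
              boundary_property C f g (sweep_set X C f g a b) x b))"
proof -
  note left = boundary_property_left_endpoint[OF assms(2-4,6,8,9)]
  note right = boundary_property_right_endpoint[OF assms(2-4,6,8,9)]
  obtain x l where x: "x \<in> X" "f x \<in> C" and l: "l \<in> I" "f x + l *\<^sub>R g x \<in> - C"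
    using assms(7,9) by blast
  have "l \<noteq> 0" using x l by auto
  moreover have "0 \<le> l" if "bdd_below I \<and> Inf I = 0" using that cInf_lower[OF l(1)] by simp
  moreover have "l \<le> 0" if "bdd_above I \<and> Sup I = 0" using that cSup_upper[OF l(1)] by simp
  \<comment> \<open>If \<open>l > 0\<close>, then \<open>Sup I = 0\<close> is impossible, so the
    last claim is vacuous and the left endpoint settles the other two. The case \<open>l < 0\<close>
    is symmetric.\<close>
  ultimately consider "l > 0" "\<not> (bdd_above I \<and> Sup I = 0)" | "l < 0" "\<not> (bdd_below I \<and> Inf I = 0)"
    by fastforce
  then show ?thesis
  proof cases
    case 1
    from left[OF x l(1) 1(1) l(2)] show ?thesis using 1(2) by metis
  next
    case 2
    from right[OF x l(1) 2(1) l(2)] show ?thesis using 2(2) by metis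
  qed
qed

end
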